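(* Let $L$ be a locally compact frame and let $e\colon L\to L^\delta$ be a canonical extension of $L$. Then $L^\delta$ is isomorphic (as a complete lattice) to the lattice $\mathrm{Up}(\mathrm{pt}(L))$ of saturated subsets of the space $\mathrm{pt}(L)$.
   Context: The axiom of choice is assumed. A frame is a complete lattice in which finite meets distribute over arbitrary joins. For $a,c$ in a frame $L$, $c\ll a$ means: for every directed $D\subseteq L$, $a\le\bigvee D$ implies $c\le d$ for some $d\in D$. $L$ is locally compact (continuous) if $a=\bigvee\{c\mid c\ll a\}$, a directed join, for every $a\in L$. A filter of $L$ is an upset closed under finite meets (the improper filter is allowed). A filter $\kappa\subseteq L$ is Scott-open if, whenever $D\subseteq L$ is directed and $\bigvee D\in\kappa$, then $d\in\kappa$ for some $d\in D$. $L^{\wedge}$ denotes the set of Scott-open filters of $L$, ordered by reverse inclusion. A canonical extension of a frame $L$ is a monotone map $e\colon L\to L^\delta$ into a complete lattice $L^\delta$ such that: (Dense) for all $u,v\in L^\delta$: $u\le v$ holds provided that for all $\kappa\in L^{\wedge}$ and $a\in L$, the inequalities $\bigwedge e[\kappa]\le u$ and $v\le e(a)$ together imply $\bigwedge e[\kappa]\le e(a)$; (Compact) if $\bigwedge e[\kappa]\le e(a)$ for some $\kappa\in L^{\wedge}$ and $a\in L$, then $a\in\kappa$. Every frame has a canonical extension, unique up to isomorphism. $\mathrm{pt}(L)$ is the space of frame homomorphisms $p\colon L\to\mathbf 2$ (two-element frame), with open sets $\{p\mid p(a)=1\}$ for $a\in L$. The specialisation order of a space $(X,\tau)$ is $x\le_\tau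 y$ iff every $U\in\tau$ containing $x$ contains $y$. $\mathrm{Up}(X)$ is the set of saturated subsets of $X$, i.e. upsets for $\le_\tau$, ordered by inclusion. *)

theory Defs
  imports "HOL-Analysis.Abstract_Topology"
begin

section \<open>Frames\<close>

text \<open>The library class \<open>complete_distrib_lattice\<close> asks for complete distributivity, which is
  strictly stronger than the frame law.\<close>

class frame = complete_lattice +
  assumes inf_Sup_frame: "inf a (Sup B) = Sup (inf a ` B)"

instance bool :: frame
  by standard (auto simp: inf_bool_def)

definition directed :: "'a::order set \<Rightarrow> bool" where
  "directed D \<longleftrightarrow> D \<noteq> {} \<and> (\<forall>x\<in>D. \<forall>y\<in>D. \<exists>z\<in>D. x \<le> z \<and> y \<le> z)"

definition way_below :: "'a::complete_lattice \<Rightarrow> 'a \<Rightarrow> bool"  (infix \<open>\<lless>\<close> 50) where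
  "c \<lless> a \<longleftrightarrow> (\<forall>D. directed D \<and> a \<le> Sup D \<longrightarrow> (\<exists>d\<in>D. c \<le> d))"

lemma directed_way_below: "directed {c. c \<lless> a}"
proof -
  have "bot \<lless> a"
    by (auto simp: way_below_def directed_def)
  moreover have "sup x y \<lless> a" if "x \<lless> a" "y \<lless> a" for x y
    unfolding way_below_def
  proof (intro allI impI)
    fix D assume D: "directed D \<and> a \<le> Sup D"
    with that obtain d d' where "d \<in> D" "x \<le> d" "d' \<in> D" "y \<le> d'"
      unfolding way_below_def by blast
    moreover from this D obtain z where "z \<in> D" "d \<le> z" "d' \<le> z"
      unfolding directed_def by blast
    ultimately show "\<exists>z\<in>D. sup x y \<le> z"
      by (meson le_supI order_trans)
  qed
  ultimately show ?thesis
    unfolding directed_def by (blast intro: sup_ge1 sup_ge2)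
qed

text \<open>By \<open>directed_way_below\<close>, the join in the following definition is always directed.\<close>

definition locally_compact_frame :: "'a::frame itself \<Rightarrow> bool" where
  "locally_compact_frame _ \<longleftrightarrow> (\<forall>a::'a. a = Sup {c. c \<lless> a})"

section \<open>Scott-open filters and canonical extensions\<close>

text \<open>Closure under the empty meet is \<open>top \<in> F\<close>; the improper filter \<open>UNIV\<close> is allowed.\<close>

definition lattice_filter :: "'a::frame set \<Rightarrow> bool" where
  "lattice_filter F \<longleftrightarrow>
     (\<forall>x\<in>F. \<forall>y. x \<le> y \<longrightarrow> y \<in> F) \<and> top \<in> F \<and> (\<forall>x\<in>F. \<forall>y\<in>F. inf x y \<in> F)"

definition scott_open_filters :: "'a::frame set set" where
  "scott_open_filters =
     {\<kappa>. lattice_filter \<kappa> \<and> (\<forall>D. directed D \<and> Sup D \<in> \<kappa> \<longrightarrow> (\<exists>d\<in>D. d \<in> \<kappa>))}"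

definition canonical_extension :: "('a::frame \<Rightarrow> 'b::complete_lattice) \<Rightarrow> bool" where
  "canonical_extension e \<longleftrightarrow>
     mono e \<and>
     (\<forall>u v. (\<forall>\<kappa>\<in>scott_open_filters. \<forall>a. Inf (e ` \<kappa>) \<le> u \<and> v \<le> e a \<longrightarrow> Inf (e ` \<kappa>) \<le> e a)
        \<longrightarrow> u \<le> v) \<and>
     (\<forall>\<kappa>\<in>scott_open_filters. \<forall>a. Inf (e ` \<kappa>) \<le> e a \<longrightarrow> a \<in> \<kappa>)"

section \<open>The space of points and saturated sets\<close>

definition frame_hom :: "('a::frame \<Rightarrow> 'b::frame) \<Rightarrow> bool" where
  "frame_hom h \<longleftrightarrow>
     h top = top \<and> (\<forall>x y. h (inf x y) = inf (h x) (h y)) \<and> (\<forall>A. h (Sup A) = Sup (h ` A))"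

text \<open>The two-element frame is \<open>bool\<close>, so \<open>p a\<close> reads as \<open>p(a) = 1\<close>.\<close>

definition pt :: "('a::frame \<Rightarrow> bool) topology" where
  "pt = topology (\<lambda>U. \<exists>a. U = {p. frame_hom p \<and> p a})"

lemma openin_pt: "openin pt U \<longleftrightarrow> (\<exists>a. U = {p. frame_hom p \<and> p a})"
proof -
  have "istopology (\<lambda>U. \<exists>a::'a. U = {p. frame_hom p \<and> p a})"
    unfolding istopology_def
  proof (intro conjI allI impI)
    fix S T :: "('a \<Rightarrow> bool) set"
    assume "\<exists>a. S = {p. frame_hom p \<and> p a}" "\<exists>a. T = {p. frame_hom p \<and> p a}"
    then obtain a b where "S = {p. frame_hom p \<and> p a}" "T = {p. frame_hom p \<and> p b}"
      by blast
    then have "S \<inter> T = {p. frame_hom p \<and> p (inf a b)}"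
      by (auto simp: frame_hom_def)
    then show "\<exists>a. S \<inter> T = {p. frame_hom p \<and> p a}" by blast
  next
    fix K :: "('a \<Rightarrow> bool) set set"
    assume "\<forall>S\<in>K. \<exists>a. S = {p. frame_hom p \<and> p a}"
    then obtain f where f: "\<forall>S\<in>K. S = {p. frame_hom p \<and> p (f S)}"
      by (auto dest: bchoice)
    have "\<Union>K = (\<Union>S\<in>K. S)" by simp
    also have "\<dots> = (\<Union>S\<in>K. {p. frame_hom p \<and> p (f S)})"
      using f by (intro SUP_cong) simp_all
    also have "\<dots> = {p. frame_hom p \<and> p (Sup (f ` K))}"
      by (auto simp: frame_hom_def)
    finally show "\<exists>a. \<Union>K = {p. frame_hom p \<and> p a}" by blast
  qed
  then show ?thesis by (simp add: pt_def topology_inverse')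
qed

lemma topspace_pt: "topspace pt = {p. frame_hom p}"
proof
  obtain a where "topspace pt = {p::'a \<Rightarrow> bool. frame_hom p \<and> p a}"
    using openin_topspace[of pt] unfolding openin_pt by blast
  then show "topspace pt \<subseteq> {p::'a \<Rightarrow> bool. frame_hom p}"
    by blast
  have "openin pt {p::'a \<Rightarrow> bool. frame_hom p \<and> p top}"
    unfolding openin_pt by blast
  then show "{p. frame_hom p} \<subseteq> topspace (pt :: ('a \<Rightarrow> bool) topology)"
    by (auto simp: frame_hom_def dest!: openin_subset)
qed

definition specialisation_le :: "'c topology \<Rightarrow> 'c \<Rightarrow> 'c \<Rightarrow> bool" where
  "specialisation_le X x y \<longleftrightarrow> (\<forall>U. openin X U \<and> x \<in> U \<longrightarrow> y \<in> U)"

definition Up :: "'c topology \<Rightarrow> 'c set set" where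
  "Up X = {S. S \<subseteq> topspace X \<and>
              (\<forall>x\<in>S. \<forall>y\<in>topspace X. specialisation_le X x y \<longrightarrow> y \<in> S)}"

lemma Up_Union: "\<S> \<subseteq> Up X \<Longrightarrow> \<Union>\<S> \<in> Up X"
  unfolding Up_def by blast

lemma Up_Inter: "\<S> \<subseteq> Up X \<Longrightarrow> topspace X \<inter> \<Inter>\<S> \<in> Up X"
  unfolding Up_def by blast

text \<open>By the two lemmas above, \<open>Up X\<close> ordered by inclusion is a complete lattice with union as
  join and intersection, taken inside \<open>topspace X\<close> so as to cover the empty family, as meet.\<close>

definition complete_lattice_iso_Up :: "('b::complete_lattice \<Rightarrow> 'c set) \<Rightarrow> 'c topology \<Rightarrow> bool" where
  "complete_lattice_iso_Up \<phi> X \<longleftrightarrow>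
     bij_betw \<phi> UNIV (Up X) \<and>
     (\<forall>u v. u \<le> v \<longleftrightarrow> \<phi> u \<subseteq> \<phi> v) \<and>
     (\<forall>A. \<phi> (Sup A) = \<Union>(\<phi> ` A)) \<and>
     (\<forall>A. \<phi> (Inf A) = topspace X \<inter> \<Inter>(\<phi> ` A))"

end

(* The isomorphism sends u to the set of points p whose completely prime filter \<kappa> satisfies
   Inf (e ` \<kappa>) \<le> u.  It is an order embedding because, by Zorn's lemma, each Scott-open filter is
   an intersection of completely prime ones.  It is onto because a point q has a largest element m
   with q m = 0: then e m separates the filter of q from the filters of all points p with
   p \<le> q failing. *)

theory Submission
  imports Defs
begin

lemma frame_hom_mono:
  assumes "frame_hom h" "x \<le> y"
  shows "h x \<le> h y"
  using assms unfolding frame_hom_def by (metis inf.absorb_iff2)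

text \<open>The frame law for a two-element join gives one binary distributive law, and the dual law
  follows from it. It is what makes maximal elements outside a filter prime.\<close>

lemma sup_inf_distrib_frame: "sup m (inf x y) = inf (sup m x) (sup m (y::'a::frame))"
proof -
  have distrib: "inf a (sup b c) = sup (inf a b) (inf a c)" for a b c :: 'a
    using inf_Sup_frame[of a "{b, c}"] by simp
  have "inf (sup m x) (sup m y) = sup (inf (sup m x) m) (inf (sup m x) y)"
    by (rule distrib)
  also have "\<dots> = sup m (sup (inf m y) (inf x y))"
    by (metis distrib inf.commute inf_sup_absorb)
  also have "\<dots> = sup m (inf x y)"
    by (simp add: sup.assoc[symmetric])
  finally show ?thesis ..
qed

lemma scott_open_filter_point:
  assumes "frame_hom p"
  shows "Collect p \<in> scott_open_filters"
  using assms frame_hom_mono[OF assms]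
  by (auto simp: scott_open_filters_def lattice_filter_def frame_hom_def)

text \<open>Scott-openness says that the complement of \<kappa> is closed under directed joins, in
  particular under joins of nonempty chains, so Zorn's lemma applies.\<close>

lemma scott_open_filter_maximal_outside:
  assumes \<kappa>: "\<kappa> \<in> scott_open_filters" and a: "a \<notin> \<kappa>"
  obtains m where "a \<le> m" "m \<notin> \<kappa>" "\<And>x. x \<notin> \<kappa> \<Longrightarrow> m \<le> x \<Longrightarrow> x = m"
proof -
  let ?A = "{x. x \<notin> \<kappa> \<and> a \<le> x}"
  have po: "partial_order_on ?A (relation_of (\<le>) ?A)"
    by (rule partial_order_on_relation_ofI) auto
  have "\<exists>u\<in>?A. \<forall>x\<in>C. x \<le> u" if C: "C \<in> Chains (relation_of (\<le>) ?A)" for C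
  proof (cases "C = {}")
    \<comment> \<open>The empty chain is bounded by \<open>a\<close>; its join \<open>bot\<close>
      need not lie above \<open>a\<close>.\<close>
    case True
    then show ?thesis using a by auto
  next
    case False
    from C have sub: "C \<subseteq> ?A" and "\<forall>x\<in>C. \<forall>y\<in>C. x \<le> y \<or> y \<le> x"
      by (auto simp: Chains_def relation_of_def)
    with False have "directed C"
      unfolding directed_def by blast
    with \<kappa> sub have "Sup C \<notin> \<kappa>"
      unfolding scott_open_filters_def by blast
    moreover from False sub have "a \<le> Sup C"
      by (auto intro: Sup_upper2)
    ultimately show ?thesis
      by (auto intro: Sup_upper)
  qed
  then have "\<exists>m\<in>?A. \<forall>x\<in>?A. m \<le> x \<longrightarrow> x = m"
    by (rule predicate_Zorn[OF po])
  with that show ?thesis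
    by (auto intro: order_trans)
qed

text \<open>An element \<open>m\<close> maximal outside \<kappa> is prime, and the elements not
  below a prime form a completely prime filter, that is, a point.\<close>

lemma separating_point:
  assumes \<kappa>: "\<kappa> \<in> scott_open_filters" and "a \<notin> \<kappa>"
  obtains p where "frame_hom p" "\<kappa> \<subseteq> Collect p" "\<not> p a"
proof -
  obtain m where m: "a \<le> m" "m \<notin> \<kappa>" and max: "\<And>x. x \<notin> \<kappa> \<Longrightarrow> m \<le> x \<Longrightarrow> x = m"
    using scott_open_filter_maximal_outside[OF assms] by blast
  have filt: "lattice_filter \<kappa>"
    using \<kappa> by (simp add: scott_open_filters_def)
  have prime: "x \<le> m \<or> y \<le> m" if "inf x y \<le> m" for x y
  proof (rule ccontr)
    assume "\<not> (x \<le> m \<or> y \<le> m)"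
    \<comment> \<open>Both joins lie strictly above \<open>m\<close>, so maximality forces them into
      \<kappa>.\<close>
    then have "sup m x \<in> \<kappa>" "sup m y \<in> \<kappa>"
      using max by (metis sup_ge1 sup_ge2)+
    then have "sup m (inf x y) \<in> \<kappa>"
      using filt by (simp add: sup_inf_distrib_frame lattice_filter_def)
    with that m show False
      by (simp add: sup_absorb1)
  qed
  have "\<not> top \<le> m"
    using filt m by (auto simp: lattice_filter_def top_unique)
  \<comment> \<open>Primality gives preservation of binary meets; joins are preserved because
    \<open>Sup A \<le> m\<close> holds iff every member of \<open>A\<close> is below
    \<open>m\<close>.\<close>
  with prime have "frame_hom (\<lambda>x. \<not> x \<le> m)"
    by (auto simp: frame_hom_def Sup_le_iff intro: le_infI1 le_infI2)
  moreover have "\<kappa> \<subseteq> {x. \<not> x \<le> m}"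
    using filt m by (auto simp: lattice_filter_def)
  ultimately show ?thesis
    using m that by simp
qed

lemma specialisation_le_pt:
  assumes "frame_hom p" "frame_hom q"
  shows "specialisation_le pt p q \<longleftrightarrow> Collect p \<subseteq> Collect q"
  using assms by (auto simp: specialisation_le_def openin_pt)

lemma canonical_extension_Inf_le_iff:
  assumes "canonical_extension e" "\<kappa> \<in> scott_open_filters"
  shows "Inf (e ` \<kappa>) \<le> e a \<longleftrightarrow> a \<in> \<kappa>"
  using assms unfolding canonical_extension_def by (blast intro: Inf_lower)

definition points_below :: "('a::frame \<Rightarrow> 'b::complete_lattice) \<Rightarrow> 'b \<Rightarrow> ('a \<Rightarrow> bool) set" where
  "points_below e u = {p. frame_hom p \<and> Inf (e ` Collect p) \<le> u}"

text \<open>Going up in the specialisation order enlarges the filter of a point and so lowers the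
  meet of its image.\<close>

lemma points_below_in_Up: "points_below e u \<in> Up pt"
  unfolding Up_def points_below_def
  by (auto simp: topspace_pt specialisation_le_pt intro: order_trans[OF Inf_superset_mono[OF image_mono]])

text \<open>Density reduces \<open>u \<le> v\<close> to a test on \<kappa> and \<open>a\<close>. If
  the test failed, a point separating \<kappa> from \<open>a\<close> would lie in
  \<open>points_below e u\<close>, hence in \<open>points_below e v\<close>, against
  compactness.\<close>

lemma points_below_subset_iff:
  assumes e: "canonical_extension e"
  shows "points_below e u \<subseteq> points_below e v \<longleftrightarrow> u \<le> v"
proof
  assume sub: "points_below e u \<subseteq> points_below e v"
  have "Inf (e ` \<kappa>) \<le> e a"
    if \<kappa>: "\<kappa> \<in> scott_open_filters" and le: "Inf (e ` \<kappa>) \<le> u" "v \<le> e a" for \<kappa> a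
  proof (rule ccontr)
    assume "\<not> Inf (e ` \<kappa>) \<le> e a"
    then have "a \<notin> \<kappa>"
      by (auto intro: Inf_lower)
    then obtain p where p: "frame_hom p" "\<kappa> \<subseteq> Collect p" "\<not> p a"
      using \<kappa> separating_point by blast
    have "Inf (e ` Collect p) \<le> Inf (e ` \<kappa>)"
      using p by (intro Inf_superset_mono image_mono)
    with p le sub have "Inf (e ` Collect p) \<le> e a"
      unfolding points_below_def by (blast intro: order_trans)
    with p show False
      using canonical_extension_Inf_le_iff[OF e scott_open_filter_point] by blast
  qed
  with e show "u \<le> v"
    unfolding canonical_extension_def by blast
qed (auto simp: points_below_def intro: order_trans)

lemma points_below_Sup:
  assumes e: "canonical_extension e" and S: "S \<in> Up pt"
  shows "points_below e (Sup ((\<lambda>p. Inf (e ` Collect p)) ` S)) = S" (is "points_below e ?u = S")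
proof
  show "S \<subseteq> points_below e ?u"
    using S by (auto simp: Up_def topspace_pt points_below_def intro: Sup_upper)
  show "points_below e ?u \<subseteq> S"
  proof (rule ccontr)
    assume "\<not> points_below e ?u \<subseteq> S"
    then obtain q where q: "frame_hom q" "Inf (e ` Collect q) \<le> ?u" "q \<notin> S"
      by (auto simp: points_below_def)
    \<comment> \<open>As \<open>q\<close> preserves joins, this is the largest element that
      \<open>q\<close> sends to 0.\<close>
    let ?m = "Sup {a. \<not> q a}"
    have "Inf (e ` Collect p) \<le> e ?m" if "p \<in> S" for p
    proof -
      have p: "frame_hom p"
        using that S by (auto simp: Up_def topspace_pt)
      then have "\<not> Collect p \<subseteq> Collect q"
        using that S q by (auto simp: Up_def topspace_pt specialisation_le_pt)
      \<comment> \<open>Some \<open>a\<close> has \<open>p a\<close> but not \<open>q a\<close>;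
        such an \<open>a\<close> is below \<open>?m\<close>.\<close>
      then have "p ?m"
        using p by (auto simp: frame_hom_def)
      then show ?thesis
        by (auto intro: Inf_lower)
    qed
    then have "?u \<le> e ?m"
      by (auto intro: Sup_least)
    \<comment> \<open>Compactness for the filter of \<open>q\<close> turns the inequality below
      \<open>e ?m\<close> into membership of \<open>?m\<close>.\<close>
    with q have "q ?m"
      using canonical_extension_Inf_le_iff[OF e scott_open_filter_point] order_trans by blast
    moreover have "\<not> q ?m"
      using q by (auto simp: frame_hom_def)
    ultimately show False
      by blast
  qed
qed

theorem mainTheorem3:
  fixes e :: "'a::frame \<Rightarrow> 'b::complete_lattice"
  assumes "locally_compact_frame TYPE('a)"
    and "canonical_extension e"
  shows "\<exists>\<phi> :: 'b \<Rightarrow> ('a \<Rightarrow> bool) set. complete_lattice_iso_Up \<phi> (pt :: ('a \<Rightarrow> bool) topology)"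
proof (intro exI[of _ "points_below e"])
  note iff = points_below_subset_iff[OF assms(2)]
  have inj: "inj (points_below e)"
    by (rule injI) (metis antisym iff order_refl)
  have range: "range (points_below e) = Up pt"
  proof
    show "range (points_below e) \<subseteq> Up pt"
      using points_below_in_Up by blast
    show "Up pt \<subseteq> range (points_below e)"
      using points_below_Sup[OF assms(2)] by (metis rangeI subsetI)
  qed
  have Sup: "points_below e (Sup A) = \<Union>(points_below e ` A)" for A
  proof
    \<comment> \<open>By surjectivity the union is the image of some \<open>w\<close>, and
      reflecting the order makes \<open>w\<close> an upper bound of \<open>A\<close>.\<close>
    have "\<Union>(points_below e ` A) \<in> Up pt"
      by (rule Up_Union) (auto simp: points_below_in_Up)
    then obtain w where w: "points_below e w = \<Union>(points_below e ` A)"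
      using range by (metis rangeE)
    have "u \<le> w" if "u \<in> A" for u
      using that unfolding iff[symmetric] w by blast
    then have "Sup A \<le> w"
      by (rule Sup_least)
    then show "points_below e (Sup A) \<subseteq> \<Union>(points_below e ` A)"
      unfolding w[symmetric] iff .
    show "\<Union>(points_below e ` A) \<subseteq> points_below e (Sup A)"
      by (simp add: UN_subset_iff iff Sup_upper)
  qed
  have Inf: "points_below e (Inf A) = topspace pt \<inter> \<Inter>(points_below e ` A)" for A
    by (auto simp: points_below_def topspace_pt le_Inf_iff)
  show "complete_lattice_iso_Up (points_below e) pt"
    unfolding complete_lattice_iso_Up_def bij_betw_def
    using inj range Sup Inf by (simp add: iff)
qed

end
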